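(* Let $R\cong\mathbb F_{q_1}\times\cdots\times\mathbb F_{q_t}$ and $S\cong\mathbb F_{q_1'}\times\cdots\times\mathbb F_{q_{t'}'}$ be finite reduced rings (products of finite fields of the indicated orders) with $t,t'\ge 3$. If $\mathcal D(R)\cong\mathcal D(S)$ as abstract graphs, then $t=t'$ and $\{q_1,\dots,q_t\}=\{q_1',\dots,q_t'\}$ as multisets; consequently $R\cong S$.
   Context: For a finite commutative ring $R$, $Z(R)$ is the set of zero-divisors of $R$ and $Z(R)^*=Z(R)\setminus\{0\}$. $\Gamma(R)$ is the simple graph with vertex set $Z(R)^*$, with distinct $x,y$ adjacent iff $xy=0$. $W\Gamma(R)$ is the simple graph with vertex set $Z(R)^*$, with distinct $x,y$ adjacent iff there exist nonzero $r\in\operatorname{Ann}(x)$ and nonzero $s\in\operatorname{Ann}(y)$ with $rs=0$. The weak zero-divisor difference graph $\mathcal D(R)$ is the graph on $Z(R)^*$ with edge set $E(W\Gamma(R))\setminus E(\Gamma(R))$, with resulting isolated vertices deleted. *)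

theory Defs
  imports "HOL-Algebra.Algebra" "Graph_Theory.Graph_Theory"
begin

definition zero_divisors :: "('a, 'm) ring_scheme \<Rightarrow> 'a set" where
  "zero_divisors R =
     {x \<in> carrier R. \<exists>y \<in> carrier R. y \<noteq> \<zero>\<^bsub>R\<^esub> \<and> x \<otimes>\<^bsub>R\<^esub> y = \<zero>\<^bsub>R\<^esub>}"

definition nonzero_zero_divisors :: "('a, 'm) ring_scheme \<Rightarrow> 'a set" where
  "nonzero_zero_divisors R = zero_divisors R - {\<zero>\<^bsub>R\<^esub>}"

definition Ann :: "('a, 'm) ring_scheme \<Rightarrow> 'a \<Rightarrow> 'a set" where
  "Ann R x = {r \<in> carrier R. r \<otimes>\<^bsub>R\<^esub> x = \<zero>\<^bsub>R\<^esub>}"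

text \<open>Simple graphs are symmetric loop-free pair digraphs: an undirected edge between
  \<open>x\<close> and \<open>y\<close> is the pair of arcs \<open>(x, y)\<close>, \<open>(y, x)\<close>.\<close>

definition zero_divisor_graph :: "('a, 'm) ring_scheme \<Rightarrow> 'a pair_pre_digraph" where
  "zero_divisor_graph R =
     \<lparr> pverts = nonzero_zero_divisors R,
       parcs = {(x, y). x \<in> nonzero_zero_divisors R \<and> y \<in> nonzero_zero_divisors R \<and>
                  x \<noteq> y \<and> x \<otimes>\<^bsub>R\<^esub> y = \<zero>\<^bsub>R\<^esub>} \<rparr>"

definition weak_zero_divisor_graph :: "('a, 'm) ring_scheme \<Rightarrow> 'a pair_pre_digraph" where
  "weak_zero_divisor_graph R =
     \<lparr> pverts = nonzero_zero_divisors R,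
       parcs = {(x, y). x \<in> nonzero_zero_divisors R \<and> y \<in> nonzero_zero_divisors R \<and>
                  x \<noteq> y \<and>
                  (\<exists>r \<in> Ann R x - {\<zero>\<^bsub>R\<^esub>}. \<exists>s \<in> Ann R y - {\<zero>\<^bsub>R\<^esub>}.
                     r \<otimes>\<^bsub>R\<^esub> s = \<zero>\<^bsub>R\<^esub>)} \<rparr>"

definition delete_isolated :: "'a pair_pre_digraph \<Rightarrow> 'a pair_pre_digraph" where
  "delete_isolated G =
     \<lparr> pverts = {x \<in> pverts G. \<exists>y. (x, y) \<in> parcs G \<or> (y, x) \<in> parcs G},
       parcs = parcs G \<rparr>"

definition weak_zero_divisor_difference_graph ::
    "('a, 'm) ring_scheme \<Rightarrow> 'a pair_pre_digraph" where
  "weak_zero_divisor_difference_graph R =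
     delete_isolated
       \<lparr> pverts = nonzero_zero_divisors R,
         parcs = parcs (weak_zero_divisor_graph R) - parcs (zero_divisor_graph R) \<rparr>"

lemma pair_graph_weak_zero_divisor_difference_graph:
  assumes "cring R" and "finite (carrier R)"
  shows "pair_graph (weak_zero_divisor_difference_graph R)"
proof -
  interpret cring R by fact
  have fin: "finite (nonzero_zero_divisors R)"
    using assms(2) by (simp add: nonzero_zero_divisors_def zero_divisors_def)
  have carr: "x \<in> carrier R" if "x \<in> nonzero_zero_divisors R" for x
    using that by (simp add: nonzero_zero_divisors_def zero_divisors_def)
  let ?D = "weak_zero_divisor_difference_graph R"
  let ?N = "nonzero_zero_divisors R"
  have sub: "parcs ?D \<subseteq> ?N \<times> ?N"
    by (auto simp: weak_zero_divisor_difference_graph_def delete_isolated_def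
        weak_zero_divisor_graph_def)
  have symD: "sym (parcs ?D)"
  proof (rule symI)
    fix x y assume a: "(x, y) \<in> parcs ?D"
    then have xy: "x \<in> ?N" "y \<in> ?N" "x \<noteq> y" "x \<otimes>\<^bsub>R\<^esub> y \<noteq> \<zero>\<^bsub>R\<^esub>"
      by (auto simp: weak_zero_divisor_difference_graph_def delete_isolated_def
          weak_zero_divisor_graph_def zero_divisor_graph_def)
    from a obtain r s where rs: "r \<in> Ann R x - {\<zero>\<^bsub>R\<^esub>}" "s \<in> Ann R y - {\<zero>\<^bsub>R\<^esub>}"
      "r \<otimes>\<^bsub>R\<^esub> s = \<zero>\<^bsub>R\<^esub>"
      by (auto simp: weak_zero_divisor_difference_graph_def delete_isolated_def
          weak_zero_divisor_graph_def)
    have "s \<otimes>\<^bsub>R\<^esub> r = \<zero>\<^bsub>R\<^esub>"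
      using rs m_comm[of s r] by (simp add: Ann_def)
    moreover have "y \<otimes>\<^bsub>R\<^esub> x \<noteq> \<zero>\<^bsub>R\<^esub>"
      using xy m_comm[of y x] carr by simp
    ultimately show "(y, x) \<in> parcs ?D"
      using xy rs
      by (auto simp: weak_zero_divisor_difference_graph_def delete_isolated_def
          weak_zero_divisor_graph_def zero_divisor_graph_def)
  qed
  have verts: "x \<in> pverts ?D \<and> y \<in> pverts ?D" if "(x, y) \<in> parcs ?D" for x y
    using that sub unfolding weak_zero_divisor_difference_graph_def delete_isolated_def
    by auto
  show ?thesis
  proof
    fix e assume e: "e \<in> parcs ?D"
    show "fst e \<in> pverts ?D" "snd e \<in> pverts ?D"
      using verts[of "fst e" "snd e"] e by simp_all
    show "fst e \<noteq> snd e"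
      using e by (auto simp: weak_zero_divisor_difference_graph_def delete_isolated_def
          weak_zero_divisor_graph_def)
  next
    show "finite (pverts ?D)"
      using fin by (simp add: weak_zero_divisor_difference_graph_def delete_isolated_def)
    show "finite (parcs ?D)"
      using sub fin by (meson finite_SigmaI finite_subset)
    show "Digraph.symmetric (with_proj ?D)"
      using symD by (simp add: Digraph.symmetric_def)
  qed
qed

end

theory Submission
  imports Defs "HOL-Computational_Algebra.Polynomial"
begin

text \<open>An element of a product of \<open>t\<close> fields is described, up to zero products, by its support
  \<open>A \<subseteq> {..<t}\<close>. Distinct nonzero zero-divisors are adjacent in \<open>\<D>(R)\<close> iff their supports meet and
  they do not share a support of size \<open>t - 1\<close>. Hence two distinct vertices have product zero
  iff they are non-adjacent and have different neighbourhoods, so \<open>\<D>(R)\<close> determines the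
  zero-divisor graph. There the order of the annihilators recovers inclusion of supports, and the
  class of vertices with minimal support \<open>{i}\<close> has \<open>q\<^sub>i - 1\<close> elements. This gives a bijection
  between the factors preserving the orders, and finite fields of the same order are
  isomorphic.\<close>

hide_const (open) Polynomial.order

section \<open>Finite fields of equal order\<close>

context ring
begin

definition int_emb :: "int \<Rightarrow> 'a" where
  "int_emb k = add_pow R k \<one>"

lemma int_emb_closed [simp]: "int_emb k \<in> carrier R"
  by (simp add: int_emb_def)

lemma int_emb_0 [simp]: "int_emb 0 = \<zero>"
  by (simp add: int_emb_def add_pow_int_ge)

lemma int_emb_1 [simp]: "int_emb 1 = \<one>"
  by (simp add: int_emb_def)

lemma int_emb_add: "int_emb (i + j) = int_emb i \<oplus> int_emb j"
  by (simp add: int_emb_def add.int_pow_mult)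

lemma int_emb_mult: "int_emb (i * j) = int_emb i \<otimes> int_emb j"
  by (simp add: int_emb_def add_pow_ldistr_int add.int_pow_pow mult.commute)

lemma int_emb_uminus: "int_emb (- i) = \<ominus> int_emb i"
  by (simp add: int_emb_def add.int_pow_neg)

text \<open>Horner evaluation. Coefficients are integers so that one and the same polynomial can be
  evaluated in two different fields, which is how those fields get compared.\<close>

definition int_eval :: "'a \<Rightarrow> int poly \<Rightarrow> 'a" where
  "int_eval a f = fold_coeffs (\<lambda>c s. int_emb c \<oplus> a \<otimes> s) f \<zero>"

lemma int_eval_0 [simp]: "int_eval a 0 = \<zero>"
  by (simp add: int_eval_def)

lemma int_eval_pCons [simp]:
  "a \<in> carrier R \<Longrightarrow> int_eval a (pCons c f) = int_emb c \<oplus> a \<otimes> int_eval a f"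
  by (cases "c = 0 \<and> f = 0") (auto simp: int_eval_def)

lemma int_eval_closed [simp]: "a \<in> carrier R \<Longrightarrow> int_eval a f \<in> carrier R"
  by (induction f) auto

lemma int_eval_1 [simp]: "a \<in> carrier R \<Longrightarrow> int_eval a 1 = \<one>"
  by (simp add: one_pCons)

end

context cring
begin

lemma int_eval_add:
  assumes a: "a \<in> carrier R"
  shows "int_eval a (f + g) = int_eval a f \<oplus> int_eval a g"
proof (induction f arbitrary: g)
  case (pCons c f)
  obtain d g' where g: "g = pCons d g'" by (cases g)
  show ?case using a by (simp add: g pCons.IH int_emb_add r_distr a_ac)
qed (use a in simp)

lemma int_eval_smult:
  assumes a: "a \<in> carrier R"
  shows "int_eval a (smult c f) = int_emb c \<otimes> int_eval a f"
  by (induction f) (use a in \<open>simp_all add: int_emb_mult r_distr m_lcomm\<close>)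

lemma int_eval_mult:
  assumes a: "a \<in> carrier R"
  shows "int_eval a (f * g) = int_eval a f \<otimes> int_eval a g"
  by (induction f)
    (use a in \<open>simp_all add: int_eval_add int_eval_smult l_distr m_assoc\<close>)

lemma int_eval_diff:
  assumes a: "a \<in> carrier R"
  shows "int_eval a (f - g) = int_eval a f \<ominus> int_eval a g"
proof -
  have "f - g = f + smult (-1) g" by simp
  then show ?thesis
    using a by (simp only: int_eval_add int_eval_smult int_emb_uminus)
      (simp add: l_minus a_minus_def)
qed

lemma int_eval_monom:
  assumes a: "a \<in> carrier R"
  shows "int_eval a (Polynomial.monom c n) = int_emb c \<otimes> a [^] n"
  by (induction n) (use a in \<open>simp_all add: monom_0 monom_Suc m_ac\<close>)

text \<open>Links Horner evaluation to the power sum used for evaluation in \<open>UP R\<close>.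
  Splitting off the constant coefficient lowers the degree bound \<open>n\<close> by one, hence
  induction on \<open>n\<close>.\<close>

lemma int_eval_finsum:
  assumes a: "a \<in> carrier R"
  shows "Polynomial.degree f \<le> n \<Longrightarrow>
    int_eval a f = (\<Oplus>i\<in>{..n}. int_emb (Polynomial.coeff f i) \<otimes> a [^] i)"
proof (induction n arbitrary: f)
  case 0
  then obtain c where "f = [:c:]" using degree_eq_zeroE by blast
  then show ?case using a by simp
next
  case (Suc n)
  obtain c g where f: "f = pCons c g" by (cases f)
  then have g: "Polynomial.degree g \<le> n" using Suc.prems by (auto split: if_splits)
  have "(\<Oplus>i\<in>{..Suc n}. int_emb (Polynomial.coeff f i) \<otimes> a [^] i) =
    (\<Oplus>i\<in>{..n}. a \<otimes> (int_emb (Polynomial.coeff g i) \<otimes> a [^] i)) \<oplus> int_emb c"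
    using a by (subst finsum_Suc2) (auto simp: f m_ac)
  also have "\<dots> = a \<otimes> int_eval a g \<oplus> int_emb c"
    using a by (simp add: finsum_rdistr Suc.IH[OF g])
  finally show ?case using a f by (simp add: a_comm)
qed

end

section \<open>Roots, orders and characteristic in a finite field\<close>

lemma (in field) card_roots_int_poly_le:
  assumes fin: "finite (carrier R)" and monic: "lead_coeff f = (1::int)"
  shows "card {a \<in> carrier R. int_eval a f = \<zero>} \<le> Polynomial.degree f"
proof -
  \<comment> \<open>The coefficient function of the image of \<open>f\<close> in the polynomial ring
    over \<open>R\<close>. Elements of \<open>UP R\<close> are such functions, so \<open>p\<close>
    itself is the polynomial.\<close>
  define p where "p = (\<lambda>i. int_emb (Polynomial.coeff f i))"
  have p_closed [simp]: "p i \<in> carrier R" for i by (simp add: p_def)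
  \<comment> \<open>Since \<open>f\<close> is monic, its image stays nonzero and keeps its degree in
    every characteristic, so \<open>roots_bound\<close> applies to it.\<close>
  have p_lead: "p (Polynomial.degree f) = \<one>" using monic by (simp add: p_def)
  have bound: "bound \<zero> (Polynomial.degree f) p"
    by (auto simp: p_def bound_def coeff_eq_0)
  then have up: "p \<in> up R" by (auto simp: up_def)
  then have p: "p \<in> carrier (UP R)" and coeff: "up_ring.coeff (UP R) p = p"
    by (simp_all add: UP_def)
  have sum: "int_eval a f = (\<Oplus>i\<in>{..Polynomial.degree f}. p i \<otimes> a [^] i)"
    if "a \<in> carrier R" for a
    using int_eval_finsum[OF that order_refl] by (simp add: p_def)
  interpret UP_domain R "UP R" by unfold_locales
  have deg: "deg R p = Polynomial.degree f"
    using bound p by (intro antisym deg_aboveI deg_belowI) (auto simp: coeff p_lead bound_def)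
  have nz: "p \<noteq> \<zero>\<^bsub>UP R\<^esub>"
  proof
    assume "p = \<zero>\<^bsub>UP R\<^esub>"
    then have "up_ring.coeff (UP R) p (Polynomial.degree f) = \<zero>" by simp
    then show False by (simp add: coeff p_lead)
  qed
  have eval: "UnivPoly.eval R R id a p = ring.int_eval R a f" if "a \<in> carrier R" for a
    using p that by (simp add: eval_on_carrier deg coeff) (simp add: sum)
  have "{a \<in> carrier R. UnivPoly.eval R R id a p = \<zero>} = {a \<in> carrier R. ring.int_eval R a f = \<zero>}"
    by (rule Collect_cong) (metis eval)
  with roots_bound[OF p nz fin] deg show ?thesis by metis
qed

text \<open>Lagrange in the multiplicative group, whose order is one less than that of the field;
  zero is treated separately.\<close>

lemma (in field) finite_field_pow_order:
  assumes fin: "finite (carrier R)" and a: "a \<in> carrier R"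
  shows "a [^] order R = a"
proof (cases "a = \<zero>")
  case True
  then show ?thesis using fin order_gt_0_iff_finite by (simp add: nat_pow_zero)
next
  case False
  interpret G: group "Multiplicative_Group.mult_of R"
    rewrites "([^]\<^bsub>Multiplicative_Group.mult_of R\<^esub>) = (([^]) :: _ \<Rightarrow> nat \<Rightarrow> _)" and "\<one>\<^bsub>Multiplicative_Group.mult_of R\<^esub> = \<one>"
    by (rule field_mult_group) (simp_all add: fun_eq_iff nat_pow_def)
  have "a [^] order (Multiplicative_Group.mult_of R) = \<one>"
    using False a fin by (intro G.pow_order_eq_1) auto
  moreover have "order R = Suc (order (Multiplicative_Group.mult_of R))"
    using fin order_gt_0_iff_finite by (simp add: order_mult_of)
  ultimately show ?thesis using a by simp
qed

text \<open>Sylow with exponent 1 serves as Cauchy's theorem: some nonzero \<open>x\<close> is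
  killed by adding it \<open>p\<close> times, and \<open>x\<close> cancels in a field.\<close>

lemma (in field) int_emb_prime_dvd_order:
  assumes fin: "finite (carrier R)" and p: "Factorial_Ring.prime p" "p dvd order R"
  shows "int_emb (int p) = \<zero>"
proof -
  obtain m where "order R = p ^ 1 * m" using p(2) by auto
  then have "order (add_monoid R) = p ^ 1 * m" by (simp add: Coset.order_def)
  from sylow_thm[OF p(1) add.is_group this] fin
  obtain H where H: "subgroup H (add_monoid R)" "card H = p" by auto
  interpret H: subgroup H "add_monoid R" by (fact H(1))
  have "\<exists>x\<in>H. x \<noteq> \<zero>"
  proof (rule ccontr)
    assume "\<not> ?thesis"
    then have "H \<subseteq> {\<zero>}" by auto
    from card_mono[OF _ this] show False using H(2) prime_gt_1_nat[OF p(1)] by simp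
  qed
  then obtain x where x: "x \<in> H" "x \<noteq> \<zero>" by blast
  have xc: "x \<in> carrier R" using x H.mem_carrier by auto
  interpret HG: group "add_monoid R\<lparr>carrier := H\<rparr>"
    using H.subgroup_is_group[OF add.is_group] by simp
  have "x [^]\<^bsub>add_monoid R\<lparr>carrier := H\<rparr>\<^esub> p = \<one>\<^bsub>add_monoid R\<lparr>carrier := H\<rparr>\<^esub>"
    using HG.pow_order_eq_1[of x] H(2) x(1) by (simp add: Coset.order_def)
  then have "add_pow R p x = \<zero>"
    by (simp add: add_pow_def nat_pow_def)
  then have "int_emb (int p) \<otimes> x = \<zero>"
    using xc by (simp add: int_emb_def add_pow_ldistr add_pow_int_ge)
  then show ?thesis using x(2) xc integral[of "int_emb (int p)" x] by simp
qed


text \<open>Thus \<open>p\<close> is the characteristic. If \<open>p\<close> did not divide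
  \<open>k\<close>, a Bezout combination of \<open>p\<close> and \<open>k\<close> would send 1 to
  zero.\<close>

lemma (in field) int_emb_eq_0_iff:
  assumes fin: "finite (carrier R)" and p: "Factorial_Ring.prime p" "p dvd order R"
  shows "int_emb k = \<zero> \<longleftrightarrow> int p dvd k"
proof
  assume k: "int_emb k = \<zero>"
  show "int p dvd k"
  proof (rule ccontr)
    assume "\<not> int p dvd k"
    then have "coprime (int p) k"
      using p(1) by (simp add: prime_imp_coprime)
    then obtain u v where uv: "u * int p + v * k = 1"
      using bezout_int[of "int p" k] by auto
    have "int_emb (u * int p + v * k) = \<zero>"
      using k int_emb_prime_dvd_order[OF fin p] by (simp add: int_emb_add int_emb_mult)
    then show False by (simp add: uv)
  qed
next
  assume "int p dvd k"
  then show "int_emb k = \<zero>"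
    using int_emb_prime_dvd_order[OF fin p] by (auto simp: int_emb_mult)
qed

text \<open>The kernel of evaluation at a generator \<open>a\<close> of \<open>K\<close> is the ideal \<open>(p, m)\<close> of \<open>\<int>[X]\<close>, where \<open>m\<close> is
  a monic integer polynomial of least degree in it. In \<open>L\<close> the multiple \<open>X\<^sup>q - X\<close> of \<open>m\<close> modulo \<open>p\<close>
  vanishes everywhere, while its cofactor has too few roots for that, so \<open>m\<close> has a root in \<open>L\<close>.\<close>

lemma finite_fields_common_int_root:
  assumes "field K" "finite (carrier K)" and "field L" "finite (carrier L)"
    and order: "order K = order L" and a: "a \<in> carrier K"
  obtains b where "b \<in> carrier L"
    and "\<And>f. ring.int_eval K a f = \<zero>\<^bsub>K\<^esub> \<Longrightarrow> ring.int_eval L b f = \<zero>\<^bsub>L\<^esub>"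
proof -
  interpret K: field K by fact
  interpret L: field L by fact
  define q where "q = order K"
  have q: "q \<ge> 2"
    using card_mono[OF assms(2), of "{\<zero>\<^bsub>K\<^esub>, \<one>\<^bsub>K\<^esub>}"] by (simp add: q_def Coset.order_def)
  then obtain p where p: "Factorial_Ring.prime p" "p dvd q"
    using prime_factor_nat[of q] by auto
  \<comment> \<open>The characteristic is read off from the order alone, so \<open>K\<close> and
    \<open>L\<close> share it.\<close>
  have zeroK: "K.int_emb k = \<zero>\<^bsub>K\<^esub> \<longleftrightarrow> int p dvd k" for k
    using p assms(2) by (intro K.int_emb_eq_0_iff) (auto simp: q_def)
  have zeroL: "L.int_emb k = \<zero>\<^bsub>L\<^esub> \<longleftrightarrow> int p dvd k" for k
    using p assms(4) order by (intro L.int_emb_eq_0_iff) (auto simp: q_def)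
  define w :: "int poly" where "w = Polynomial.monom 1 q - Polynomial.monom 1 1"
  have wK: "K.int_eval a w = \<zero>\<^bsub>K\<^esub>"
    using a K.finite_field_pow_order[OF assms(2) a]
    by (simp add: w_def K.int_eval_diff K.int_eval_monom q_def)
  have wL: "L.int_eval b w = \<zero>\<^bsub>L\<^esub>" if "b \<in> carrier L" for b
    using that L.finite_field_pow_order[OF assms(4) that] order
    by (simp add: w_def L.int_eval_diff L.int_eval_monom q_def)
  have degw: "Polynomial.degree w = q" "lead_coeff w = 1"
  proof -
    have "Polynomial.degree w = Polynomial.degree (Polynomial.monom (1::int) q)"
      using q unfolding w_def by (subst diff_conv_add_uminus, intro degree_add_eq_left) (simp add: degree_monom_eq)
    then show "Polynomial.degree w = q" by (simp add: degree_monom_eq)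
    then show "lead_coeff w = 1" using q by (simp add: w_def)
  qed
  define M where "M = {f. lead_coeff f = (1::int) \<and> K.int_eval a f = \<zero>\<^bsub>K\<^esub>}"
  define m where "m = arg_min Polynomial.degree (\<lambda>f. f \<in> M)"
  have "w \<in> M" using wK degw by (simp add: M_def)
  then have m: "m \<in> M" and least: "\<And>f. f \<in> M \<Longrightarrow> Polynomial.degree m \<le> Polynomial.degree f"
    unfolding m_def by (auto intro: arg_min_natI arg_min_nat_le)
  have m0: "m \<noteq> 0" using m by (auto simp: M_def)
  have degm: "Polynomial.degree m > 0"
  proof (rule ccontr)
    assume "\<not> ?thesis"
    then obtain c where "m = [:c:]" using degree_eq_zeroE by blast
    then have "m = 1" using m by (simp add: M_def one_pCons)
    then show False using m a by (simp add: M_def)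
  qed
  \<comment> \<open>An element of the kernel of degree below that of \<open>m\<close> has leading
    coefficient divisible by \<open>p\<close>. Its leading term therefore vanishes in both fields
    and can be stripped, and induction on the degree finishes.\<close>
  have small: "L.int_eval b r = \<zero>\<^bsub>L\<^esub>"
    if "K.int_eval a r = \<zero>\<^bsub>K\<^esub>" "Polynomial.degree r < Polynomial.degree m" "b \<in> carrier L" for r b
    using that
  proof (induction "Polynomial.degree r" arbitrary: r rule: less_induct)
    case less
    let ?c = "lead_coeff r" and ?d = "Polynomial.degree r"
    have "int p dvd ?c"
    proof (rule ccontr)
      assume nd: "\<not> int p dvd ?c"
      then have "coprime (int p) ?c" using p(1) by (simp add: prime_imp_coprime)
      then obtain u v where uv: "u * int p + v * ?c = 1"
        using bezout_int[of "int p" ?c] by auto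
      \<comment> \<open>Here \<open>v\<close> inverts the leading coefficient modulo
        \<open>p\<close>. The added term makes it exactly 1 and still evaluates to zero in
        \<open>K\<close>, so \<open>f\<close> is a monic kernel element of degree less than
        \<open>m\<close>.\<close>
      define f where "f = smult v r + Polynomial.monom (u * int p) ?d"
      have cf: "Polynomial.coeff f ?d = 1" using uv by (simp add: f_def algebra_simps)
      have "Polynomial.degree f \<le> ?d"
        unfolding f_def by (intro degree_add_le) (auto simp: degree_monom_le)
      moreover have "?d \<le> Polynomial.degree f" using cf by (intro le_degree) simp
      ultimately have df: "Polynomial.degree f = ?d" by simp
      have "K.int_eval a f = \<zero>\<^bsub>K\<^esub>"
        using a less.prems(1) zeroK[of "u * int p"]
        by (simp add: f_def K.int_eval_add K.int_eval_smult K.int_eval_monom)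
      then have "f \<in> M" using cf df by (simp add: M_def)
      from least[OF this] less.prems(2) df show False by simp
    qed
    define r' where "r' = r - Polynomial.monom ?c ?d"
    have r: "r = r' + Polynomial.monom ?c ?d" by (simp add: r'_def)
    have K': "K.int_eval a r' = \<zero>\<^bsub>K\<^esub>"
      using a less.prems(1) zeroK[of ?c] \<open>int p dvd ?c\<close>
      by (simp add: r'_def K.int_eval_diff K.int_eval_monom)
    have "L.int_eval b r' = \<zero>\<^bsub>L\<^esub>"
    proof (cases "?d = 0")
      case True
      then obtain c where "r = [:c:]" using degree_eq_zeroE by blast
      then have "r' = 0" by (simp add: r'_def monom_0)
      then show ?thesis by simp
    next
      case False
      have "Polynomial.degree r' \<le> ?d"
        unfolding r'_def by (intro degree_diff_le) (auto simp: degree_monom_le)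
      moreover have "Polynomial.coeff r' ?d = 0" by (simp add: r'_def)
      ultimately have "Polynomial.degree r' < ?d"
        using False by (metis degree_0 eq_zero_or_degree_less gr0I)
      then show ?thesis using less K' by auto
    qed
    then show ?case
      using less.prems(3) zeroL[of ?c] \<open>int p dvd ?c\<close>
      by (subst r) (simp add: L.int_eval_add L.int_eval_monom)
  qed
  \<comment> \<open>As \<open>m\<close> is monic, pseudo-division scales \<open>f\<close> by a power
    of 1 and is honest division over the integers.\<close>
  have division: "\<exists>h r. f = m * h + r \<and> Polynomial.degree r < Polynomial.degree m" for f
  proof -
    obtain h r where hr: "pseudo_divmod f m = (h, r)" by fastforce
    have "f = m * h + r" using pseudo_divmod(1)[OF m0 hr] m by (simp add: M_def)
    moreover have "Polynomial.degree r < Polynomial.degree m"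
      using pseudo_divmod(2)[OF m0 hr] degm by auto
    ultimately show ?thesis by blast
  qed
  \<comment> \<open>When \<open>f\<close> lies in the kernel, so does its remainder, and
    \<open>small\<close> makes that remainder vanish on all of \<open>L\<close>.\<close>
  have rem: "L.int_eval b r = \<zero>\<^bsub>L\<^esub>"
    if "m * h + r = f" "K.int_eval a f = \<zero>\<^bsub>K\<^esub>" "Polynomial.degree r < Polynomial.degree m" "b \<in> carrier L" for f h r b
  proof -
    have "K.int_eval a (m * h + r) = K.int_eval a r"
      using m a by (simp add: K.int_eval_add K.int_eval_mult M_def)
    then show ?thesis using that small by simp
  qed
  obtain h r where hr: "w = m * h + r" "Polynomial.degree r < Polynomial.degree m"
    using division by blast
  have mh: "m * h = w - r" using hr by simp
  have "Polynomial.degree m \<le> q" using least[OF \<open>w \<in> M\<close>] degw by simp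
  \<comment> \<open>Subtracting \<open>r\<close> from \<open>w\<close> leaves the leading term
    alone, because \<open>r\<close> has degree below that of \<open>m\<close>, which is at most
    \<open>q\<close>.\<close>
  have "Polynomial.degree (m * h) = q" "lead_coeff (m * h) = 1"
  proof -
    have "Polynomial.degree (w + - r) = q"
      using hr(2) degw \<open>Polynomial.degree m \<le> q\<close> by (subst degree_add_eq_left) auto
    then show dmh: "Polynomial.degree (m * h) = q" by (simp add: mh)
    show "lead_coeff (m * h) = 1"
      using hr(2) degw \<open>Polynomial.degree m \<le> q\<close> by (simp only: dmh) (simp add: mh coeff_eq_0)
  qed
  moreover have "h \<noteq> 0" using calculation(2) by auto
  ultimately have h: "lead_coeff h = 1" "Polynomial.degree h + Polynomial.degree m = q"
    using m m0 lead_coeff_mult[of m h] degree_mult_eq[of m h] by (auto simp: M_def)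
  \<comment> \<open>The monic cofactor \<open>h\<close> has degree less than \<open>q\<close>, so
    some \<open>b\<close> among the \<open>q\<close> elements of \<open>L\<close> is not a root of
    it. There \<open>w\<close> vanishes and \<open>h\<close> does not, which forces \<open>m\<close>
    to vanish.\<close>
  have "card {b \<in> carrier L. L.int_eval b h = \<zero>\<^bsub>L\<^esub>} < card (carrier L)"
    using L.card_roots_int_poly_le[OF assms(4) h(1)] h(2) degm order
    by (simp add: q_def Coset.order_def)
  then have "{b \<in> carrier L. L.int_eval b h = \<zero>\<^bsub>L\<^esub>} \<noteq> carrier L" by auto
  then obtain b where b: "b \<in> carrier L" "L.int_eval b h \<noteq> \<zero>\<^bsub>L\<^esub>" by auto
  have "L.int_eval b w = L.int_eval b m \<otimes>\<^bsub>L\<^esub> L.int_eval b h"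
    using b(1) rem[OF hr(1)[symmetric] wK hr(2) b(1)]
    by (simp add: hr(1) L.int_eval_add L.int_eval_mult)
  then have mb: "L.int_eval b m = \<zero>\<^bsub>L\<^esub>"
    using wL[OF b(1)] b L.integral[of "L.int_eval b m" "L.int_eval b h"] by auto
  show thesis
  proof (rule that[OF b(1)])
    fix f assume f: "K.int_eval a f = \<zero>\<^bsub>K\<^esub>"
    obtain g s where gs: "f = m * g + s" "Polynomial.degree s < Polynomial.degree m"
      using division by blast
    show "L.int_eval b f = \<zero>\<^bsub>L\<^esub>"
      using b(1) mb rem[OF gs(1)[symmetric] f gs(2) b(1)]
      by (simp add: gs(1) L.int_eval_add L.int_eval_mult)
  qed
qed

text \<open>Let \<open>a\<close> generate the multiplicative group of \<open>K\<close>, so that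
  every element of \<open>K\<close> is an integer polynomial in \<open>a\<close>. With a common root
  \<open>b\<close> in \<open>L\<close>, replacing \<open>a\<close> by \<open>b\<close> defines a
  homomorphism; it is injective on a field and surjective by counting.\<close>

theorem finite_fields_same_order_iso:
  assumes "field K" "finite (carrier K)" and "field L" "finite (carrier L)"
    and order: "order K = order L"
  shows "K \<simeq> L"
proof -
  interpret K: field K by fact
  interpret L: field L by fact
  obtain a where a: "a \<in> carrier (Multiplicative_Group.mult_of K)"
    and gen: "carrier (Multiplicative_Group.mult_of K) = {a [^]\<^bsub>K\<^esub> i | i::nat. i \<in> UNIV}"
    using K.finite_field_mult_group_has_gen[OF assms(2)] by blast
  then have aK: "a \<in> carrier K" by simp
  obtain b where b: "b \<in> carrier L"
    and zero: "\<And>f. K.int_eval a f = \<zero>\<^bsub>K\<^esub> \<Longrightarrow> L.int_eval b f = \<zero>\<^bsub>L\<^esub>"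
    using finite_fields_common_int_root[OF assms aK] by blast
  define h where "h x = L.int_eval b (SOME f. K.int_eval a f = x)" for x
  \<comment> \<open>The choice inside \<open>h\<close> is harmless: two polynomials with equal
    values at \<open>a\<close> differ by one vanishing at \<open>a\<close>, hence also at
    \<open>b\<close>.\<close>
  have h: "h (K.int_eval a f) = L.int_eval b f" for f
  proof -
    define g where "g = (SOME g. K.int_eval a g = K.int_eval a f)"
    have "K.int_eval a g = K.int_eval a f" unfolding g_def by (rule someI) (rule refl)
    then have "K.int_eval a (g - f) = \<zero>\<^bsub>K\<^esub>" using aK by (simp add: K.int_eval_diff)
    from zero[OF this] have "L.int_eval b g \<ominus>\<^bsub>L\<^esub> L.int_eval b f = \<zero>\<^bsub>L\<^esub>"
      using b by (simp add: L.int_eval_diff)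
    then show ?thesis using b by (simp add: h_def flip: g_def)
  qed
  have surj: "\<exists>f. x = K.int_eval a f" if "x \<in> carrier K" for x
  proof (cases "x = \<zero>\<^bsub>K\<^esub>")
    case False
    then have "x \<in> carrier (Multiplicative_Group.mult_of K)" using that by simp
    then obtain i :: nat where "x = a [^]\<^bsub>K\<^esub> i" using gen by auto
    then have "x = K.int_eval a (Polynomial.monom 1 i)" using aK by (simp add: K.int_eval_monom)
    then show ?thesis by blast
  next
    case True
    then have "x = K.int_eval a 0" by simp
    then show ?thesis by blast
  qed
  have hom: "h \<in> ring_hom K L"
  proof (rule ring_hom_memI)
    show "h x \<in> carrier L" if "x \<in> carrier K" for x
    proof -
      obtain f where "x = K.int_eval a f" using surj[OF \<open>x \<in> carrier K\<close>] by blast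
      then show ?thesis using b by (simp only: h L.int_eval_closed)
    qed
    show "h (x \<otimes>\<^bsub>K\<^esub> y) = h x \<otimes>\<^bsub>L\<^esub> h y" if "x \<in> carrier K" "y \<in> carrier K" for x y
    proof -
      obtain f g where "x = K.int_eval a f" "y = K.int_eval a g"
        using surj[OF \<open>x \<in> carrier K\<close>] surj[OF \<open>y \<in> carrier K\<close>] by blast
      then show ?thesis by (simp only: h K.int_eval_mult[OF aK, symmetric] L.int_eval_mult[OF b])
    qed
    show "h (x \<oplus>\<^bsub>K\<^esub> y) = h x \<oplus>\<^bsub>L\<^esub> h y" if "x \<in> carrier K" "y \<in> carrier K" for x y
    proof -
      obtain f g where "x = K.int_eval a f" "y = K.int_eval a g"
        using surj[OF \<open>x \<in> carrier K\<close>] surj[OF \<open>y \<in> carrier K\<close>] by blast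
      then show ?thesis by (simp only: h K.int_eval_add[OF aK, symmetric] L.int_eval_add[OF b])
    qed
    show "h \<one>\<^bsub>K\<^esub> = \<one>\<^bsub>L\<^esub>" using h[of 1] aK b by simp
  qed
  then interpret h: ring_hom_ring K L h by (intro ring_hom_ringI2) unfold_locales
  have "h \<one>\<^bsub>K\<^esub> \<noteq> \<zero>\<^bsub>L\<^esub>" by simp
  then have inj: "inj_on h (carrier K)"
    using K.one_closed by (intro h.non_trivial_field_hom_imp_inj assms) blast
  have "h ` carrier K = carrier L"
    using hom inj order assms(4)
    by (intro card_subset_eq) (auto simp: card_image Coset.order_def ring_hom_def)
  then show ?thesis
    using hom inj by (auto simp: is_ring_iso_def ring_iso_def bij_betw_def)
qed

section \<open>Reading off supports from adjacency\<close>

text \<open>The first condition on supports says that the product is nonzero. The excluded case is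
  where weak adjacency fails: both annihilators are then the same single factor \<open>i\<close>, in
  which nonzero elements have nonzero products.\<close>

definition support_adj :: "('a \<Rightarrow> nat set) \<Rightarrow> nat \<Rightarrow> 'a \<Rightarrow> 'a \<Rightarrow> bool" where
  "support_adj s t x y \<longleftrightarrow>
     x \<noteq> y \<and> s x \<inter> s y \<noteq> {} \<and> \<not> (s x = s y \<and> (\<exists>i<t. s x = {..<t} - {i}))"

text \<open>Keeps only the combinatorics of a product of \<open>t\<close> fields: each nonempty
  proper index set occurs as a support, with arbitrary multiplicity.\<close>

locale support_map =
  fixes V :: "'a set" and s :: "'a \<Rightarrow> nat set" and t :: nat
  assumes image: "s ` V = {A. A \<subseteq> {..<t} \<and> A \<noteq> {} \<and> A \<noteq> {..<t}}"
    and t: "t \<ge> 3"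
begin

lemma support_nonempty: "x \<in> V \<Longrightarrow> s x \<noteq> {}"
  and support_subset: "x \<in> V \<Longrightarrow> s x \<subseteq> {..<t}"
  and support_proper: "x \<in> V \<Longrightarrow> s x \<noteq> {..<t}"
  using image by blast+

lemma obtain_support:
  assumes "A \<subseteq> {..<t}" "A \<noteq> {}" "i < t" "i \<notin> A"
  obtains x where "x \<in> V" "s x = A"
proof -
  have "A \<in> s ` V" using assms by (auto simp: image)
  then show thesis using that by blast
qed

text \<open>The form in which \<open>t \<ge> 3\<close> enters: two indices never exhaust
  \<open>{..<t}\<close>.\<close>

lemma other_index:
  obtains c where "c < t" "c \<noteq> a" "c \<noteq> b"
proof -
  have "\<not> {..<3} \<subseteq> {a, b}"
    using card_mono[of "{a, b}" "{..<3::nat}"] card_insert_le_m1[of 2 "{b}" a] by auto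
  then show thesis using that t by force
qed

lemma obtain_singleton:
  assumes "i < t"
  obtains x where "x \<in> V" "s x = {i}"
proof -
  obtain j where "j < t" "j \<noteq> i" by (rule other_index)
  then show thesis using assms obtain_support[of "{i}" j] that by auto
qed

text \<open>A support larger than \<open>{i}\<close> meets the different support \<open>{i}\<close>.
  A support equal to \<open>{i}\<close> meets \<open>{i, j}\<close>, which is proper thanks to a
  third index.\<close>

lemma no_isolated:
  assumes x: "x \<in> V"
  shows "\<exists>y\<in>V. support_adj s t x y"
proof -
  obtain i where i: "i \<in> s x" "i < t"
    using x support_nonempty support_subset by blast
  show ?thesis
  proof (cases "s x = {i}")
    case True
    obtain j where j: "j < t" "j \<noteq> i" using other_index by metis
    obtain k where k: "k < t" "k \<noteq> i" "k \<noteq> j" using other_index by metis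
    obtain y where "y \<in> V" "s y = {i, j}"
      using obtain_support[of "{i, j}" k] i j k by auto
    then show ?thesis using True j by (intro bexI[of _ y]) (auto simp: support_adj_def)
  next
    case False
    obtain y where "y \<in> V" "s y = {i}" using obtain_singleton[OF i(2)] .
    then show ?thesis using False i by (intro bexI[of _ y]) (auto simp: support_adj_def)
  qed
qed

text \<open>If \<open>j\<close> lies in one support and that support is not \<open>{j}\<close>, a
  vertex supported on \<open>{j}\<close> sees only the vertex with that support. For two singletons
  \<open>{a}\<close> and \<open>{b}\<close>, the support \<open>{a, c}\<close> with a third index
  \<open>c\<close> separates them.\<close>

lemma disjoint_supports_distinguished:
  assumes x: "x \<in> V" and y: "y \<in> V" and disj: "s x \<inter> s y = {}"
  shows "\<exists>z\<in>V. support_adj s t x z \<noteq> support_adj s t y z"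
proof -
  have nonsingle: "\<exists>z\<in>V. support_adj s t u z \<noteq> support_adj s t v z"
    if "u \<in> V" "s u \<inter> s v = {}" "j \<in> s u" "s u \<noteq> {j}" for u v j
  proof -
    have "j < t" using that support_subset by blast
    then obtain z where "z \<in> V" "s z = {j}" by (rule obtain_singleton)
    then show ?thesis using that by (intro bexI[of _ z]) (auto simp: support_adj_def)
  qed
  obtain a b where ab: "a \<in> s x" "b \<in> s y" "a < t" "b < t"
    using support_nonempty[OF x] support_nonempty[OF y] support_subset[OF x] support_subset[OF y]
    by blast
  consider "s x \<noteq> {a}" | "s y \<noteq> {b}" | "s x = {a}" "s y = {b}" by blast
  then show ?thesis
  proof cases
    case 3
    obtain c where c: "c < t" "c \<noteq> a" "c \<noteq> b" by (rule other_index)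
    have "a \<noteq> b" using 3 disj by auto
    then obtain z where "z \<in> V" "s z = {a, c}"
      using obtain_support[of "{a, c}" b] ab c by auto
    then show ?thesis using 3 c \<open>a \<noteq> b\<close> by (intro bexI[of _ z]) (auto simp: support_adj_def)
  qed (use nonsingle[of x y a] nonsingle[of y x b] x y disj ab in blast)+
qed

text \<open>Among the non-adjacent pairs, those lying in a common class of support size \<open>t - 1\<close> are
  recognised as twins; what remains is the zero-divisor graph itself.\<close>

lemma disjoint_supports_iff:
  assumes x: "x \<in> V" and y: "y \<in> V"
  shows "s x \<inter> s y = {} \<longleftrightarrow>
    x \<noteq> y \<and> \<not> support_adj s t x y \<and> (\<exists>z\<in>V. support_adj s t x z \<noteq> support_adj s t y z)"
proof
  assume "s x \<inter> s y = {}"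
  moreover from this have "x \<noteq> y" using support_nonempty[OF x] by auto
  ultimately show "x \<noteq> y \<and> \<not> support_adj s t x y \<and>
      (\<exists>z\<in>V. support_adj s t x z \<noteq> support_adj s t y z)"
    using disjoint_supports_distinguished[OF x y] by (simp add: support_adj_def)
next
  assume *: "x \<noteq> y \<and> \<not> support_adj s t x y \<and>
      (\<exists>z\<in>V. support_adj s t x z \<noteq> support_adj s t y z)"
  show "s x \<inter> s y = {}"
  proof (rule ccontr)
    assume "s x \<inter> s y \<noteq> {}"
    then have "s x = s y" "\<exists>i<t. s y = {..<t} - {i}" using * by (auto simp: support_adj_def)
    \<comment> \<open>This includes \<open>z = x\<close> and \<open>z = y\<close>: no vertex is
      adjacent to itself, and members of a common excluded class are not adjacent to each
      other.\<close>
    then have "support_adj s t x z = support_adj s t y z" for z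
      unfolding support_adj_def by metis
    then show False using * by blast
  qed
qed

text \<open>Inclusion of supports reverses inclusion of annihilators; the deciding test vertex is
  supported on the complement of \<open>s x\<close>.\<close>

lemma support_subset_iff:
  assumes x: "x \<in> V" and y: "y \<in> V"
  shows "s y \<subseteq> s x \<longleftrightarrow> (\<forall>z\<in>V. s x \<inter> s z = {} \<longrightarrow> s y \<inter> s z = {})"
proof
  assume *: "\<forall>z\<in>V. s x \<inter> s z = {} \<longrightarrow> s y \<inter> s z = {}"
  obtain i where "i \<in> s x" using support_nonempty[OF x] by blast
  then obtain z where z: "z \<in> V" "s z = {..<t} - s x"
    using obtain_support[of "{..<t} - s x" i] support_subset[OF x] support_proper[OF x] by blast
  then have "s y \<inter> s z = {}" using * by auto
  then show "s y \<subseteq> s x" using z support_subset[OF y] by auto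
qed auto

text \<open>Singletons are the minimal nonempty sets, and each of them occurs as a support.\<close>

lemma singleton_support_iff:
  assumes x: "x \<in> V"
  shows "(\<exists>i. s x = {i}) \<longleftrightarrow> (\<forall>y\<in>V. s y \<subseteq> s x \<longrightarrow> s x \<subseteq> s y)"
proof
  assume "\<exists>i. s x = {i}"
  then show "\<forall>y\<in>V. s y \<subseteq> s x \<longrightarrow> s x \<subseteq> s y" using support_nonempty by fastforce
next
  assume *: "\<forall>y\<in>V. s y \<subseteq> s x \<longrightarrow> s x \<subseteq> s y"
  obtain i where i: "i \<in> s x" "i < t" using support_nonempty[OF x] support_subset[OF x] by blast
  obtain y where "y \<in> V" "s y = {i}" using obtain_singleton[OF i(2)] .
  then show "\<exists>i. s x = {i}" using * i by (intro exI[of _ i]) auto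
qed

end

text \<open>Disjointness, inclusion and minimality of supports have all been expressed by adjacency,
  so \<open>F\<close> preserves them. It therefore maps singleton classes onto singleton classes,
  and \<open>\<sigma>\<close> is the induced map on indices.\<close>

lemma support_adj_iso_singleton_classes:
  assumes "support_map V s t" and "support_map V' s' t'"
    and F: "bij_betw F V V'"
    and adj: "\<And>x y. x \<in> V \<Longrightarrow> y \<in> V \<Longrightarrow> support_adj s t x y \<longleftrightarrow> support_adj s' t' (F x) (F y)"
  obtains \<sigma> where "bij_betw \<sigma> {..<t} {..<t'}"
    and "\<And>i. i < t \<Longrightarrow> card {x \<in> V. s x = {i}} = card {y \<in> V'. s' y = {\<sigma> i}}"
proof -
  interpret A: support_map V s t by fact
  interpret B: support_map V' s' t' by fact
  have FV: "F x \<in> V'" if "x \<in> V" for x using F that bij_betwE by blast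
  have ball: "(\<forall>y\<in>V'. P y) \<longleftrightarrow> (\<forall>x\<in>V. P (F x))" for P
    using F by (auto simp: bij_betw_def)
  have bex: "(\<exists>y\<in>V'. P y) \<longleftrightarrow> (\<exists>x\<in>V. P (F x))" for P
    using F by (auto simp: bij_betw_def)
  have disj: "s x \<inter> s y = {} \<longleftrightarrow> s' (F x) \<inter> s' (F y) = {}" if "x \<in> V" "y \<in> V" for x y
  proof -
    have "x \<noteq> y \<longleftrightarrow> F x \<noteq> F y" using F that by (auto simp: bij_betw_def inj_on_def)
    then show ?thesis
      using that FV by (simp add: A.disjoint_supports_iff B.disjoint_supports_iff bex adj)
  qed
  have sub: "s y \<subseteq> s x \<longleftrightarrow> s' (F y) \<subseteq> s' (F x)" if "x \<in> V" "y \<in> V" for x y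
    using that FV by (simp add: A.support_subset_iff B.support_subset_iff ball disj)
  have single: "(\<exists>i. s x = {i}) \<longleftrightarrow> (\<exists>i. s' (F x) = {i})" if "x \<in> V" for x
    using that FV by (simp add: A.singleton_support_iff B.singleton_support_iff ball sub)
  have eq: "s x = s y \<longleftrightarrow> s' (F x) = s' (F y)" if "x \<in> V" "y \<in> V" for x y
    using sub[OF that] sub[OF that(2,1)] by blast
  have "\<exists>x j. x \<in> V \<and> s x = {i} \<and> s' (F x) = {j}" if "i < t" for i
    using A.obtain_singleton[OF that] single by metis
  \<comment> \<open>\<open>\<xi> i\<close> represents the class of \<open>{i}\<close>, and
    \<open>\<sigma> i\<close> is read off from its image.\<close>
  then obtain \<xi> \<sigma> where \<xi>: "\<And>i. i < t \<Longrightarrow> \<xi> i \<in> V \<and> s (\<xi> i) = {i} \<and> s' (F (\<xi> i)) = {\<sigma> i}"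
    by metis
  have iff: "s x = {i} \<longleftrightarrow> s' (F x) = {\<sigma> i}" if "x \<in> V" "i < t" for x i
    using eq[of x "\<xi> i"] \<xi>[OF that(2)] that(1) by simp
  have "bij_betw \<sigma> {..<t} {..<t'}"
    unfolding bij_betw_def
  proof
    show "inj_on \<sigma> {..<t}"
    proof
      fix i j assume ij: "i \<in> {..<t}" "j \<in> {..<t}" "\<sigma> i = \<sigma> j"
      then have "s (\<xi> i) = {j}" using iff[of "\<xi> i" j] \<xi>[of i] by simp
      then show "i = j" using ij \<xi>[of i] by simp
    qed
    show "\<sigma> ` {..<t} = {..<t'}"
    proof
      show "\<sigma> ` {..<t} \<subseteq> {..<t'}"
        using B.support_subset[OF FV] \<xi> by fastforce
      show "{..<t'} \<subseteq> \<sigma> ` {..<t}"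
      proof
        fix j assume "j \<in> {..<t'}"
        then obtain y where y: "y \<in> V'" "s' y = {j}" using B.obtain_singleton by auto
        obtain x where x: "x \<in> V" "y = F x" using F y(1) by (auto simp: bij_betw_def)
        then obtain i where i: "s x = {i}" using single y by blast
        then have "i < t" using A.support_subset[OF x(1)] by auto
        then show "j \<in> \<sigma> ` {..<t}" using iff[of x i] i x y by auto
      qed
    qed
  qed
  moreover have "card {x \<in> V. s x = {i}} = card {y \<in> V'. s' y = {\<sigma> i}}" if "i < t" for i
  proof (rule bij_betw_same_card)
    show "bij_betw F {x \<in> V. s x = {i}} {y \<in> V'. s' y = {\<sigma> i}}"
      using F iff[OF _ that] by (auto simp: bij_betw_def inj_on_def)
  qed
  ultimately show thesis using that by blast
qed

section \<open>The difference graph of a ring with a support map\<close>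

locale ring_support = cring R for R (structure) +
  fixes s :: "'a \<Rightarrow> nat set" and t :: nat
  assumes support_image: "s ` carrier R = Pow {..<t}"
    and support_empty_iff: "x \<in> carrier R \<Longrightarrow> s x = {} \<longleftrightarrow> x = \<zero>"
    and mult_eq_zero_iff: "x \<in> carrier R \<Longrightarrow> y \<in> carrier R \<Longrightarrow> x \<otimes> y = \<zero> \<longleftrightarrow> s x \<inter> s y = {}"
begin

lemma obtain_elem:
  assumes "A \<subseteq> {..<t}"
  obtains x where "x \<in> carrier R" "s x = A"
proof -
  have "A \<in> s ` carrier R" using assms by (simp add: support_image)
  then show thesis using that by blast
qed

lemma support_subset: "x \<in> carrier R \<Longrightarrow> s x \<subseteq> {..<t}"
  using support_image by blast

lemma support_zero [simp]: "s \<zero> = {}"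
  by (simp add: support_empty_iff)

text \<open>An element supported on the complement of \<open>s x\<close> annihilates
  \<open>x\<close>, and it is nonzero exactly when \<open>s x\<close> is not full.\<close>

lemma nonzero_zero_divisors_eq:
  "nonzero_zero_divisors R = {x \<in> carrier R. s x \<noteq> {} \<and> s x \<noteq> {..<t}}"
proof -
  have "(\<exists>y\<in>carrier R. y \<noteq> \<zero> \<and> x \<otimes> y = \<zero>) \<longleftrightarrow> s x \<noteq> {..<t}" if x: "x \<in> carrier R" for x
  proof
    assume "\<exists>y\<in>carrier R. y \<noteq> \<zero> \<and> x \<otimes> y = \<zero>"
    then obtain y where y: "y \<in> carrier R" "s y \<noteq> {}" "s x \<inter> s y = {}"
      using x by (auto simp: mult_eq_zero_iff support_empty_iff)
    then show "s x \<noteq> {..<t}" using support_subset[OF y(1)] by blast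
  next
    assume "s x \<noteq> {..<t}"
    moreover obtain y where y: "y \<in> carrier R" "s y = {..<t} - s x"
      using obtain_elem[of "{..<t} - s x"] by blast
    ultimately have "s y \<noteq> {}" "s x \<inter> s y = {}" using support_subset[OF x] by auto
    then show "\<exists>y\<in>carrier R. y \<noteq> \<zero> \<and> x \<otimes> y = \<zero>"
      using x y(1) by (auto simp: mult_eq_zero_iff support_empty_iff)
  qed
  then show ?thesis
    by (auto simp: nonzero_zero_divisors_def zero_divisors_def support_empty_iff)
qed

lemma support_map_nonzero_zero_divisors:
  assumes "t \<ge> 3"
  shows "support_map (nonzero_zero_divisors R) s t"
proof
  show "s ` nonzero_zero_divisors R = {A. A \<subseteq> {..<t} \<and> A \<noteq> {} \<and> A \<noteq> {..<t}}"
  proof -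
    have "s ` nonzero_zero_divisors R = {A \<in> s ` carrier R. A \<noteq> {} \<and> A \<noteq> {..<t}}"
      unfolding nonzero_zero_divisors_eq by blast
    then show ?thesis by (simp add: support_image)
  qed
qed fact

text \<open>Annihilators of \<open>x\<close> and \<open>y\<close> are supported in the complements
  of \<open>s x\<close> and \<open>s y\<close>. Nonzero ones with disjoint supports exist unless
  both complements are the same singleton.\<close>

lemma weak_adj_iff:
  assumes x: "x \<in> nonzero_zero_divisors R" and y: "y \<in> nonzero_zero_divisors R"
  shows "(\<exists>r\<in>Ann R x - {\<zero>}. \<exists>u\<in>Ann R y - {\<zero>}. r \<otimes> u = \<zero>) \<longleftrightarrow>
    \<not> (s x = s y \<and> (\<exists>i<t. s x = {..<t} - {i}))" (is "?L \<longleftrightarrow> \<not> ?E")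
proof
  have xy: "x \<in> carrier R" "y \<in> carrier R" using x y by (auto simp: nonzero_zero_divisors_eq)
  have Ann: "r \<in> Ann R z - {\<zero>} \<longleftrightarrow> r \<in> carrier R \<and> s r \<noteq> {} \<and> s r \<inter> s z = {}"
    if "z \<in> carrier R" for r z
    using that support_empty_iff[of r]
    by (auto simp: Ann_def mult_eq_zero_iff)
  {
    assume ?L
    then obtain r u where "r \<in> Ann R x - {\<zero>}" "u \<in> Ann R y - {\<zero>}" "r \<otimes> u = \<zero>"
      by blast
    then have ru: "r \<in> carrier R" "s r \<noteq> {}" "s r \<inter> s x = {}"
      "u \<in> carrier R" "s u \<noteq> {}" "s u \<inter> s y = {}" "s r \<inter> s u = {}"
      using mult_eq_zero_iff[of r u] unfolding Ann[OF xy(1)] Ann[OF xy(2)] by simp_all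
    show "\<not> ?E"
    proof
      assume ?E
      then obtain i where i: "s x = {..<t} - {i}" "s y = {..<t} - {i}" by auto
      have "s r \<subseteq> {i}" using i(1) ru(3) support_subset[OF ru(1)] by blast
      moreover have "s u \<subseteq> {i}" using i(2) ru(6) support_subset[OF ru(4)] by blast
      ultimately show False using ru(2,5,7) by blast
    qed
  next
    assume nE: "\<not> ?E"
    obtain a b where a: "a < t" "a \<notin> s x" and b: "b < t" "b \<notin> s y"
      using x y support_subset[OF xy(1)] support_subset[OF xy(2)]
      by (auto simp: nonzero_zero_divisors_eq)
    \<comment> \<open>If no two distinct missing indices could be chosen, both complements would
      reduce to \<open>{a}\<close>, the excluded case.\<close>
    have "\<exists>a b. a < t \<and> a \<notin> s x \<and> b < t \<and> b \<notin> s y \<and> a \<noteq> b"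
    proof (rule ccontr)
      assume no: "\<not> ?thesis"
      then have eq: "c = d" if "c < t" "c \<notin> s x" "d < t" "d \<notin> s y" for c d
        using that by blast
      have only: "c \<notin> s x \<Longrightarrow> c = a" "c \<notin> s y \<Longrightarrow> c = a" if "c < t" for c
        using eq[OF that _ b] eq[OF a that] eq[OF a b] by simp_all
      have "a \<notin> s y" using b eq[OF a b] by simp
      have "s x = {..<t} - {a}" using only(1) a(2) support_subset[OF xy(1)] by blast
      moreover have "s y = {..<t} - {a}" using only(2) \<open>a \<notin> s y\<close> support_subset[OF xy(2)] by blast
      ultimately show False using nE a(1) by metis
    qed
    then obtain a b where ab: "a < t" "a \<notin> s x" "b < t" "b \<notin> s y" "a \<noteq> b" by blast
    obtain r where "r \<in> carrier R" "s r = {a}" using obtain_elem[of "{a}"] ab by auto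
    moreover obtain u where "u \<in> carrier R" "s u = {b}" using obtain_elem[of "{b}"] ab by auto
    ultimately show ?L
      using ab xy by (intro bexI[of _ r] bexI[of _ u]) (simp_all only: Ann mult_eq_zero_iff, auto)
  }
qed

lemma parcs_difference_graph:
  "parcs (weak_zero_divisor_difference_graph R) =
    {(x, y). x \<in> nonzero_zero_divisors R \<and> y \<in> nonzero_zero_divisors R \<and> support_adj s t x y}"
proof -
  have "(x, y) \<in> parcs (weak_zero_divisor_graph R) - parcs (zero_divisor_graph R) \<longleftrightarrow>
      x \<in> nonzero_zero_divisors R \<and> y \<in> nonzero_zero_divisors R \<and> support_adj s t x y" for x y
  proof (cases "x \<in> nonzero_zero_divisors R \<and> y \<in> nonzero_zero_divisors R")
    case True
    then have "x \<in> carrier R" "y \<in> carrier R" by (simp_all add: nonzero_zero_divisors_eq)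
    then have "x \<otimes> y = \<zero> \<longleftrightarrow> s x \<inter> s y = {}" by (rule mult_eq_zero_iff)
    with True weak_adj_iff[of x y] show ?thesis
      by (simp add: weak_zero_divisor_graph_def zero_divisor_graph_def support_adj_def) blast
  next
    case False
    then show ?thesis by (auto simp: weak_zero_divisor_graph_def)
  qed
  then show ?thesis
    by (auto simp: weak_zero_divisor_difference_graph_def delete_isolated_def)
qed

lemma pverts_difference_graph:
  assumes "t \<ge> 3"
  shows "pverts (weak_zero_divisor_difference_graph R) = nonzero_zero_divisors R"
proof -
  interpret support_map "nonzero_zero_divisors R" s t
    by (rule support_map_nonzero_zero_divisors[OF assms])
  have "parcs (weak_zero_divisor_graph R) - parcs (zero_divisor_graph R) =
      parcs (weak_zero_divisor_difference_graph R)"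
    by (simp add: weak_zero_divisor_difference_graph_def delete_isolated_def)
  then show ?thesis
    using no_isolated parcs_difference_graph
    by (auto simp: weak_zero_divisor_difference_graph_def delete_isolated_def)
qed

end

section \<open>Products of fields\<close>

lemma RDirProd_list_Cons_mult:
  assumes "x \<in> carrier R" "y \<in> carrier R" "xs \<in> carrier (RDirProd_list Rs)" "ys \<in> carrier (RDirProd_list Rs)"
  shows "(x # xs) \<otimes>\<^bsub>RDirProd_list (R # Rs)\<^esub> (y # ys) = (x \<otimes>\<^bsub>R\<^esub> y) # (xs \<otimes>\<^bsub>RDirProd_list Rs\<^esub> ys)"
  using ring_hom_mult[OF RDirProd_list_hom1, of "(x, xs)" R Rs "(y, ys)"] assms
  by (simp add: RDirProd_carrier) (simp add: RDirProd_def DirProd_def monoid.defs)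

lemma RDirProd_list_Cons_add:
  assumes "x \<in> carrier R" "y \<in> carrier R" "xs \<in> carrier (RDirProd_list Rs)" "ys \<in> carrier (RDirProd_list Rs)"
  shows "(x # xs) \<oplus>\<^bsub>RDirProd_list (R # Rs)\<^esub> (y # ys) = (x \<oplus>\<^bsub>R\<^esub> y) # (xs \<oplus>\<^bsub>RDirProd_list Rs\<^esub> ys)"
  using ring_hom_add[OF RDirProd_list_hom1, of "(x, xs)" R Rs "(y, ys)"] assms
  by (simp add: RDirProd_carrier) (simp add: RDirProd_def DirProd_def monoid.defs)

lemma RDirProd_list_nth_mult:
  assumes "xs \<in> carrier (RDirProd_list Rs)" "ys \<in> carrier (RDirProd_list Rs)" "i < length Rs"
  shows "(xs \<otimes>\<^bsub>RDirProd_list Rs\<^esub> ys) ! i = (xs ! i) \<otimes>\<^bsub>Rs ! i\<^esub> (ys ! i)"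
  using assms
proof (induction Rs arbitrary: xs ys i)
  case (Cons R Rs)
  then show ?case
    by (cases i) (auto simp: RDirProd_list_carrier RDirProd_list_Cons_mult)
qed simp

lemma RDirProd_list_nth_add:
  assumes "xs \<in> carrier (RDirProd_list Rs)" "ys \<in> carrier (RDirProd_list Rs)" "i < length Rs"
  shows "(xs \<oplus>\<^bsub>RDirProd_list Rs\<^esub> ys) ! i = (xs ! i) \<oplus>\<^bsub>Rs ! i\<^esub> (ys ! i)"
  using assms
proof (induction Rs arbitrary: xs ys i)
  case (Cons R Rs)
  then show ?case
    by (cases i) (auto simp: RDirProd_list_carrier RDirProd_list_Cons_add)
qed simp

lemma RDirProd_list_one_eq: "\<one>\<^bsub>RDirProd_list Rs\<^esub> = map one Rs"
  unfolding RDirProd_list_one by (induction Rs) simp_all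

lemma RDirProd_list_zero_eq: "\<zero>\<^bsub>RDirProd_list Rs\<^esub> = map (\<lambda>R. \<zero>\<^bsub>R\<^esub>) Rs"
  unfolding RDirProd_list_zero by (induction Rs) simp_all

lemma RDirProd_list_carrier_iff:
  "xs \<in> carrier (RDirProd_list Rs) \<longleftrightarrow>
    length xs = length Rs \<and> (\<forall>i<length Rs. xs ! i \<in> carrier (Rs ! i))"
  using RDirProd_list_carrier_mem RDirProd_list_carrier_memI by metis

text \<open>Apply the isomorphisms of the factors coordinatewise and reorder: coordinate
  \<open>j\<close> of the image comes from coordinate \<open>\<tau> j\<close>, where
  \<open>\<tau>\<close> inverts \<open>\<sigma>\<close>.\<close>

lemma RDirProd_list_permute_iso:
  assumes rings: "\<And>R. R \<in> set Rs \<Longrightarrow> ring R" "\<And>S. S \<in> set Ss \<Longrightarrow> ring S"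
    and \<sigma>: "bij_betw \<sigma> {..<length Rs} {..<length Ss}"
    and iso: "\<And>i. i < length Rs \<Longrightarrow> Rs ! i \<simeq> Ss ! \<sigma> i"
  shows "RDirProd_list Rs \<simeq> RDirProd_list Ss"
proof -
  let ?P = "RDirProd_list Rs" and ?Q = "RDirProd_list Ss"
  have P: "ring ?P" and Q: "ring ?Q" using rings by (auto intro!: RDirProd_list_is_ring)
  define \<tau> where "\<tau> = the_inv_into {..<length Rs} \<sigma>"
  have \<tau>\<sigma>: "\<tau> (\<sigma> i) = i" if "i < length Rs" for i
    unfolding \<tau>_def using \<sigma> that by (auto simp: bij_betw_def the_inv_into_f_f)
  have \<sigma>\<tau>: "\<tau> j < length Rs" "\<sigma> (\<tau> j) = j" if "j < length Ss" for j
  proof -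
    have "j \<in> \<sigma> ` {..<length Rs}" using \<sigma> that by (auto simp: bij_betw_def)
    then show "\<tau> j < length Rs" "\<sigma> (\<tau> j) = j" using \<tau>\<sigma> by auto
  qed
  have \<sigma>_less: "\<sigma> i < length Ss" if "i < length Rs" for i
    using \<sigma> that by (auto simp: bij_betw_def)
  have "\<exists>f. f \<in> ring_iso (Rs ! \<tau> j) (Ss ! j)" if "j < length Ss" for j
    using iso[OF \<sigma>\<tau>(1)[OF that]] \<sigma>\<tau>(2)[OF that] by (auto simp: is_ring_iso_def)
  then obtain f where f: "\<And>j. j < length Ss \<Longrightarrow> f j \<in> ring_iso (Rs ! \<tau> j) (Ss ! j)" by metis
  define h where "h xs = map (\<lambda>j. f j (xs ! \<tau> j)) [0..<length Ss]" for xs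
  have h_nth: "h xs ! j = f j (xs ! \<tau> j)" "length (h xs) = length Ss" if "j < length Ss" for xs j
    using that by (simp_all add: h_def)
  have h_len: "length (h xs) = length Ss" for xs by (simp add: h_def)
  note isoD = ring_iso_memE[OF f]
  have hom: "h \<in> ring_hom ?P ?Q"
  proof (rule ring_hom_memI)
    fix xs assume xs: "xs \<in> carrier ?P"
    then show "h xs \<in> carrier ?Q"
      by (auto simp: RDirProd_list_carrier_iff h_len h_nth \<sigma>\<tau> isoD(1))
    fix ys assume ys: "ys \<in> carrier ?P"
    have mem: "h xs \<in> carrier ?Q" "h ys \<in> carrier ?Q"
      using xs ys by (auto simp: RDirProd_list_carrier_iff h_len h_nth \<sigma>\<tau> isoD(1))
    have lens: "length (u \<otimes>\<^bsub>?Q\<^esub> v) = length Ss" "length (u \<oplus>\<^bsub>?Q\<^esub> v) = length Ss"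
      if "u \<in> carrier ?Q" "v \<in> carrier ?Q" for u v
      using that ring.ring_simprules(1,5)[OF Q] RDirProd_list_carrier_mem(1) by blast+
    have c: "xs ! \<tau> j \<in> carrier (Rs ! \<tau> j)" "ys ! \<tau> j \<in> carrier (Rs ! \<tau> j)" if "j < length Ss" for j
      using xs ys \<sigma>\<tau>[OF that] by (simp_all add: RDirProd_list_carrier_iff)
    show "h (xs \<otimes>\<^bsub>?P\<^esub> ys) = h xs \<otimes>\<^bsub>?Q\<^esub> h ys"
      using mem xs ys
      by (intro nth_equalityI)
        (simp_all add: h_len lens h_nth RDirProd_list_nth_mult \<sigma>\<tau> isoD(2) c)
    show "h (xs \<oplus>\<^bsub>?P\<^esub> ys) = h xs \<oplus>\<^bsub>?Q\<^esub> h ys"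
      using mem xs ys
      by (intro nth_equalityI)
        (simp_all add: h_len lens h_nth RDirProd_list_nth_add \<sigma>\<tau> isoD(3) c)
  next
    show "h \<one>\<^bsub>?P\<^esub> = \<one>\<^bsub>?Q\<^esub>"
      by (intro nth_equalityI) (simp_all add: h_len h_nth RDirProd_list_one_eq \<sigma>\<tau> isoD(4))
  qed
  have inj: "inj_on h (carrier ?P)"
  proof
    fix xs ys assume xs: "xs \<in> carrier ?P" and ys: "ys \<in> carrier ?P" and eq: "h xs = h ys"
    show "xs = ys"
    proof (rule nth_equalityI)
      show "length xs = length ys" using xs ys by (simp add: RDirProd_list_carrier_iff)
      fix i assume "i < length xs"
      then have i: "i < length Rs" using xs by (simp add: RDirProd_list_carrier_iff)
      have "f (\<sigma> i) (xs ! i) = f (\<sigma> i) (ys ! i)"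
        using h_nth(1)[OF \<sigma>_less[OF i], of xs] h_nth(1)[OF \<sigma>_less[OF i], of ys] eq \<tau>\<sigma>[OF i]
        by simp
      moreover have "inj_on (f (\<sigma> i)) (carrier (Rs ! i))"
        using isoD(5)[OF \<sigma>_less[OF i]] \<tau>\<sigma>[OF i] by (simp add: bij_betw_def)
      ultimately show "xs ! i = ys ! i"
        using xs ys i by (auto simp: RDirProd_list_carrier_iff dest: inj_onD)
    qed
  qed
  have "carrier ?Q \<subseteq> h ` carrier ?P"
  proof
    fix ys assume ys: "ys \<in> carrier ?Q"
    define xs where "xs = map (\<lambda>i. inv_into (carrier (Rs ! i)) (f (\<sigma> i)) (ys ! \<sigma> i)) [0..<length Rs]"
    have key: "xs ! i \<in> carrier (Rs ! i) \<and> f (\<sigma> i) (xs ! i) = ys ! \<sigma> i" if i: "i < length Rs" for i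
    proof -
      have "f (\<sigma> i) ` carrier (Rs ! i) = carrier (Ss ! \<sigma> i)"
        using isoD(5)[OF \<sigma>_less[OF i]] \<tau>\<sigma>[OF i] by (simp add: bij_betw_def)
      moreover have "ys ! \<sigma> i \<in> carrier (Ss ! \<sigma> i)"
        using ys \<sigma>_less[OF i] by (simp add: RDirProd_list_carrier_iff)
      ultimately show ?thesis using i by (simp add: xs_def inv_into_into f_inv_into_f)
    qed
    have "h xs = ys"
    proof (rule nth_equalityI)
      show "length (h xs) = length ys" using ys by (simp add: h_len RDirProd_list_carrier_iff)
      fix j assume "j < length (h xs)"
      then have j: "j < length Ss" by (simp add: h_len)
      show "h xs ! j = ys ! j"
        using key[OF \<sigma>\<tau>(1)[OF j]] \<sigma>\<tau>(2)[OF j] by (simp add: h_nth[OF j])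
    qed
    moreover have "xs \<in> carrier ?P" using key by (simp add: RDirProd_list_carrier_iff xs_def)
    ultimately show "ys \<in> h ` carrier ?P" by blast
  qed
  moreover have "h ` carrier ?P \<subseteq> carrier ?Q" using hom by (auto simp: ring_hom_def)
  ultimately show ?thesis
    using hom inj by (auto simp: is_ring_iso_def ring_iso_def bij_betw_def)
qed

section \<open>Supports in a product of fields\<close>

definition product_support :: "('a, 'm) ring_scheme list \<Rightarrow> 'a list \<Rightarrow> nat set" where
  "product_support Fs xs = {i. i < length Fs \<and> xs ! i \<noteq> \<zero>\<^bsub>Fs ! i\<^esub>}"

text \<open>Fields have no zero-divisors, so the support of a product is the intersection of the
  supports. Vectors with entries zero and one realise every index set.\<close>

lemma ring_support_product_support:
  assumes "cring R" and fields: "\<And>F. F \<in> set Fs \<Longrightarrow> field F"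
    and \<phi>: "\<phi> \<in> ring_iso R (RDirProd_list Fs)"
  shows "ring_support R (product_support Fs \<circ> \<phi>) (length Fs)"
proof -
  interpret R: cring R by fact
  let ?P = "RDirProd_list Fs"
  have field_nth: "field (Fs ! i)" if "i < length Fs" for i using fields that by simp
  have P: "ring ?P"
    using fields by (auto intro!: RDirProd_list_is_ring simp: field_def domain_def cring_def)
  note \<phi>D = ring_iso_memE[OF \<phi>]
  have zero: "\<phi> \<zero>\<^bsub>R\<^esub> = \<zero>\<^bsub>?P\<^esub>"
    using ring_hom_zero[of \<phi> R ?P] \<phi> P R.ring_axioms by (simp add: ring_iso_def)
  have zero_iff: "x = \<zero>\<^bsub>R\<^esub> \<longleftrightarrow> product_support Fs (\<phi> x) = {}" if x: "x \<in> carrier R" for x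
  proof -
    have "x = \<zero>\<^bsub>R\<^esub> \<longleftrightarrow> \<phi> x = map (\<lambda>F. \<zero>\<^bsub>F\<^esub>) Fs"
      using \<phi>D(5) x zero inj_on_eq_iff[of \<phi> "carrier R" x "\<zero>\<^bsub>R\<^esub>"]
      by (simp add: bij_betw_def RDirProd_list_zero_eq)
    also have "\<dots> \<longleftrightarrow> product_support Fs (\<phi> x) = {}"
      using RDirProd_list_carrier_mem(1)[OF \<phi>D(1)[OF x]]
      by (auto simp: product_support_def list_eq_iff_nth_eq)
    finally show ?thesis .
  qed
  have mult: "product_support Fs (\<phi> (x \<otimes>\<^bsub>R\<^esub> y)) =
      product_support Fs (\<phi> x) \<inter> product_support Fs (\<phi> y)"
    if "x \<in> carrier R" "y \<in> carrier R" for x y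
  proof -
    have integral: "(\<phi> x ! i \<otimes>\<^bsub>Fs ! i\<^esub> \<phi> y ! i = \<zero>\<^bsub>Fs ! i\<^esub>) \<longleftrightarrow>
        \<phi> x ! i = \<zero>\<^bsub>Fs ! i\<^esub> \<or> \<phi> y ! i = \<zero>\<^bsub>Fs ! i\<^esub>" if i: "i < length Fs" for i
    proof -
      interpret F: field "Fs ! i" using field_nth[OF i] .
      show ?thesis
        using RDirProd_list_carrier_mem(2)[OF \<phi>D(1) i] \<open>x \<in> carrier R\<close> \<open>y \<in> carrier R\<close>
        by (intro F.integral_iff) auto
    qed
    have "product_support Fs (\<phi> (x \<otimes>\<^bsub>R\<^esub> y)) =
        {i. i < length Fs \<and> \<phi> x ! i \<otimes>\<^bsub>Fs ! i\<^esub> \<phi> y ! i \<noteq> \<zero>\<^bsub>Fs ! i\<^esub>}"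
      using that \<phi>D(1)
      by (auto simp: product_support_def \<phi>D(2) RDirProd_list_nth_mult)
    also have "\<dots> = product_support Fs (\<phi> x) \<inter> product_support Fs (\<phi> y)"
      unfolding product_support_def using integral by blast
    finally show ?thesis .
  qed
  have surj: "A \<in> (product_support Fs \<circ> \<phi>) ` carrier R" if A: "A \<subseteq> {..<length Fs}" for A
  proof -
    define xs where "xs = map (\<lambda>i. if i \<in> A then \<one>\<^bsub>Fs ! i\<^esub> else \<zero>\<^bsub>Fs ! i\<^esub>) [0..<length Fs]"
    have F: "\<one>\<^bsub>Fs ! i\<^esub> \<in> carrier (Fs ! i)" "\<zero>\<^bsub>Fs ! i\<^esub> \<in> carrier (Fs ! i)" "\<one>\<^bsub>Fs ! i\<^esub> \<noteq> \<zero>\<^bsub>Fs ! i\<^esub>"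
      if i: "i < length Fs" for i
    proof -
      interpret F: field "Fs ! i" using field_nth[OF i] .
      show "\<one>\<^bsub>Fs ! i\<^esub> \<in> carrier (Fs ! i)" "\<zero>\<^bsub>Fs ! i\<^esub> \<in> carrier (Fs ! i)" "\<one>\<^bsub>Fs ! i\<^esub> \<noteq> \<zero>\<^bsub>Fs ! i\<^esub>"
        by simp_all
    qed
    have "xs \<in> carrier ?P" using F by (auto simp: RDirProd_list_carrier_iff xs_def)
    then have "xs \<in> \<phi> ` carrier R" using \<phi>D(5) by (simp add: bij_betw_def)
    then obtain x where "x \<in> carrier R" "\<phi> x = xs" by blast
    moreover have "product_support Fs xs = A"
      using A F by (auto simp: product_support_def xs_def split: if_splits)
    ultimately show ?thesis by force
  qed
  show ?thesis
  proof
    show "(product_support Fs \<circ> \<phi>) ` carrier R = Pow {..<length Fs}"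
    proof
      show "(product_support Fs \<circ> \<phi>) ` carrier R \<subseteq> Pow {..<length Fs}"
        by (auto simp: product_support_def)
      show "Pow {..<length Fs} \<subseteq> (product_support Fs \<circ> \<phi>) ` carrier R"
        using surj by blast
    qed
    show "(product_support Fs \<circ> \<phi>) x = {} \<longleftrightarrow> x = \<zero>\<^bsub>R\<^esub>" if "x \<in> carrier R" for x
      by (simp only: zero_iff[OF that] comp_apply)
    show "x \<otimes>\<^bsub>R\<^esub> y = \<zero>\<^bsub>R\<^esub> \<longleftrightarrow>
        (product_support Fs \<circ> \<phi>) x \<inter> (product_support Fs \<circ> \<phi>) y = {}"
      if "x \<in> carrier R" "y \<in> carrier R" for x y
      by (simp only: zero_iff[OF R.m_closed[OF that]] mult[OF that] comp_apply)
  qed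
qed

text \<open>Elements supported on \<open>{i}\<close> correspond to the nonzero elements of the
  \<open>i\<close>-th field; \<open>Suc\<close> restores its zero.\<close>

lemma card_singleton_product_support:
  assumes "\<phi> \<in> ring_iso R (RDirProd_list Fs)" and "\<And>F. F \<in> set Fs \<Longrightarrow> field F"
    and i: "i < length Fs" and fin: "finite (carrier (Fs ! i))"
  shows "Suc (card {x \<in> carrier R. product_support Fs (\<phi> x) = {i}}) = order (Fs ! i)"
proof -
  let ?P = "RDirProd_list Fs"
  have field_nth: "field (Fs ! j)" if "j < length Fs" for j using assms(2) that by simp
  have zero: "\<zero>\<^bsub>Fs ! j\<^esub> \<in> carrier (Fs ! j)" if j: "j < length Fs" for j
  proof -
    interpret F: field "Fs ! j" using field_nth[OF j] .
    show ?thesis by simp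
  qed
  have "bij_betw \<phi> {x \<in> carrier R. product_support Fs (\<phi> x) = {i}}
      {xs \<in> carrier ?P. product_support Fs xs = {i}}"
    using ring_iso_memE(5)[OF assms(1)] by (auto simp: bij_betw_def inj_on_def)
  then have "card {x \<in> carrier R. product_support Fs (\<phi> x) = {i}} =
      card {xs \<in> carrier ?P. product_support Fs xs = {i}}"
    by (rule bij_betw_same_card)
  also have "\<dots> = card (carrier (Fs ! i) - {\<zero>\<^bsub>Fs ! i\<^esub>})"
  proof (rule bij_betw_same_card[OF bij_betw_byWitness])
    let ?e = "\<lambda>a. (map (\<lambda>F. \<zero>\<^bsub>F\<^esub>) Fs)[i := a]"
    show "\<forall>xs\<in>{xs \<in> carrier ?P. product_support Fs xs = {i}}. ?e (xs ! i) = xs"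
    proof
      fix xs assume "xs \<in> {xs \<in> carrier ?P. product_support Fs xs = {i}}"
      then have len: "length xs = length Fs"
        and zeros: "\<And>j. j < length Fs \<Longrightarrow> xs ! j \<noteq> \<zero>\<^bsub>Fs ! j\<^esub> \<longleftrightarrow> j = i"
        by (auto simp: RDirProd_list_carrier_iff product_support_def)
      show "?e (xs ! i) = xs"
      proof (rule nth_equalityI)
        fix j assume "j < length (?e (xs ! i))"
        then have j: "j < length Fs" by simp
        show "?e (xs ! i) ! j = xs ! j"
          using i j zeros[OF j] by (cases "j = i") simp_all
      qed (simp add: len)
    qed
    show "\<forall>a\<in>carrier (Fs ! i) - {\<zero>\<^bsub>Fs ! i\<^esub>}. ?e a ! i = a"
      using i by simp
    show "(\<lambda>xs. xs ! i) ` {xs \<in> carrier ?P. product_support Fs xs = {i}}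
        \<subseteq> carrier (Fs ! i) - {\<zero>\<^bsub>Fs ! i\<^esub>}"
      using i by (auto simp: RDirProd_list_carrier_iff product_support_def)
    show "?e ` (carrier (Fs ! i) - {\<zero>\<^bsub>Fs ! i\<^esub>})
        \<subseteq> {xs \<in> carrier ?P. product_support Fs xs = {i}}"
      using i zero
      by (auto simp: RDirProd_list_carrier_iff product_support_def nth_list_update split: if_splits)
  qed
  also have "Suc \<dots> = order (Fs ! i)"
    using zero[OF i] fin card_Suc_Diff1[OF fin zero[OF i]] by (simp add: Coset.order_def)
  finally show ?thesis .
qed

text \<open>An isomorphism of digraphs acts on arcs separately from vertices. Arcs of
  \<open>H\<close> are pairs with projections as tail and head, so the vertex map determines the arc
  map.\<close>

lemma digraph_iso_with_projD:
  assumes "digraph_iso (with_proj G) (with_proj H)"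
  obtains f where "bij_betw f (pverts G) (pverts H)"
    and "\<And>x y. x \<in> pverts G \<Longrightarrow> y \<in> pverts G \<Longrightarrow> (x, y) \<in> parcs G \<longleftrightarrow> (f x, f y) \<in> parcs H"
proof -
  obtain F where iso: "pre_digraph.digraph_isomorphism (with_proj G) F"
    and H: "with_proj H = app_iso F (with_proj G)"
    using assms unfolding digraph_iso_def by blast
  let ?f = "iso_verts F" and ?g = "iso_arcs F"
  have wf: "wf_digraph (with_proj G)" and inj: "inj_on ?f (pverts G)"
    and arc: "\<And>a. a \<in> parcs G \<Longrightarrow> ?f (fst a) = iso_tail F (?g a) \<and> ?f (snd a) = iso_head F (?g a)"
    using iso by (auto simp: pre_digraph.digraph_isomorphism_def with_proj_def)
  have "pverts H = ?f ` pverts G" "parcs H = ?g ` parcs G" "iso_tail F = fst" "iso_head F = snd"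
    using arg_cong[OF H, of verts] arg_cong[OF H, of arcs] arg_cong[OF H, of tail]
      arg_cong[OF H, of head] by (simp_all add: with_proj_def)
  note H' = this
  have g: "?g a = (?f (fst a), ?f (snd a))" if "a \<in> parcs G" for a
    using arc[OF that] H' by (simp add: prod_eq_iff)
  have ends: "fst a \<in> pverts G" "snd a \<in> pverts G" if "a \<in> parcs G" for a
    using wf_digraph.tail_in_verts[OF wf, of a] wf_digraph.head_in_verts[OF wf, of a] that
    by (simp_all add: with_proj_def)
  show thesis
  proof
    show "bij_betw ?f (pverts G) (pverts H)" using inj H' by (simp add: bij_betw_def)
    fix x y assume xy: "x \<in> pverts G" "y \<in> pverts G"
    show "(x, y) \<in> parcs G \<longleftrightarrow> (?f x, ?f y) \<in> parcs H"
    proof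
      assume "(x, y) \<in> parcs G"
      then show "(?f x, ?f y) \<in> parcs H" using g[of "(x, y)"] H'(2) by force
    next
      assume "(?f x, ?f y) \<in> parcs H"
      then obtain a where a: "a \<in> parcs G" "?g a = (?f x, ?f y)" using H'(2) by auto
      then have "?f (fst a) = ?f x" "?f (snd a) = ?f y" using g by auto
      then have "a = (x, y)" using inj ends[OF a(1)] xy by (auto simp: prod_eq_iff dest: inj_onD)
      then show "(x, y) \<in> parcs G" using a(1) by simp
    qed
  qed
qed

section \<open>Matching the factors of the two rings\<close>

lemma mset_map_nth: "mset (map f xs) = image_mset (\<lambda>i. f (xs ! i)) (mset_set {..<length xs})"
proof -
  have "map f xs = map (\<lambda>i. f (xs ! i)) [0..<length xs]"
    by (intro nth_equalityI) simp_all
  then show ?thesis by (simp only: mset_map mset_upt lessThan_atLeast0)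
qed

theorem theorem8p8:
  fixes R :: "('a, 'm) ring_scheme" and S :: "('b, 'n) ring_scheme"
    and Fs :: "('c, 'k) ring_scheme list" and Gs :: "('d, 'l) ring_scheme list"
  assumes "cring R" and "finite (carrier R)"
    and "cring S" and "finite (carrier S)"
    and "\<And>F. F \<in> set Fs \<Longrightarrow> field F \<and> finite (carrier F)"
    and "\<And>G. G \<in> set Gs \<Longrightarrow> field G \<and> finite (carrier G)"
    and "length Fs \<ge> 3" and "length Gs \<ge> 3"
    and "R \<simeq> RDirProd_list Fs" and "S \<simeq> RDirProd_list Gs"
    and "digraph_iso (with_proj (weak_zero_divisor_difference_graph R))
                     (with_proj (weak_zero_divisor_difference_graph S))"
  shows "length Fs = length Gs
    \<and> mset (map order Fs) = mset (map order Gs)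
    \<and> R \<simeq> S"
proof -
  note fields = assms(5,6)
  obtain \<phi> where \<phi>: "\<phi> \<in> ring_iso R (RDirProd_list Fs)"
    using assms(9) by (auto simp: is_ring_iso_def)
  obtain \<psi> where \<psi>: "\<psi> \<in> ring_iso S (RDirProd_list Gs)"
    using assms(10) by (auto simp: is_ring_iso_def)
  let ?s = "product_support Fs \<circ> \<phi>" and ?u = "product_support Gs \<circ> \<psi>"
  interpret R: ring_support R ?s "length Fs"
    using ring_support_product_support[OF assms(1) _ \<phi>] fields by blast
  interpret S: ring_support S ?u "length Gs"
    using ring_support_product_support[OF assms(3) _ \<psi>] fields by blast
  let ?V = "nonzero_zero_divisors R" and ?W = "nonzero_zero_divisors S"
  \<comment> \<open>With at least three factors no vertex is isolated, so both vertex sets consist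
    of all nonzero zero-divisors.\<close>
  obtain F where F: "bij_betw F ?V ?W"
    and arcs: "\<And>x y. x \<in> ?V \<Longrightarrow> y \<in> ?V \<Longrightarrow>
      (x, y) \<in> parcs (weak_zero_divisor_difference_graph R) \<longleftrightarrow>
      (F x, F y) \<in> parcs (weak_zero_divisor_difference_graph S)"
    using digraph_iso_with_projD[OF assms(11)] assms(7,8)
    by (metis R.pverts_difference_graph S.pverts_difference_graph)
  have adj: "support_adj ?s (length Fs) x y \<longleftrightarrow> support_adj ?u (length Gs) (F x) (F y)"
    if "x \<in> ?V" "y \<in> ?V" for x y
    using arcs[OF that] that bij_betwE[OF F]
    by (simp add: R.parcs_difference_graph S.parcs_difference_graph)
  obtain \<sigma> where \<sigma>: "bij_betw \<sigma> {..<length Fs} {..<length Gs}"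
    and cards: "\<And>i. i < length Fs \<Longrightarrow>
      card {x \<in> ?V. ?s x = {i}} = card {y \<in> ?W. ?u y = {\<sigma> i}}"
    using support_adj_iso_singleton_classes[OF
        R.support_map_nonzero_zero_divisors[OF assms(7)]
        S.support_map_nonzero_zero_divisors[OF assms(8)] F adj] by blast
  have len: "length Fs = length Gs" using bij_betw_same_card[OF \<sigma>] by simp
  have singleton_proper: "{i} \<noteq> {..<n}" if "n \<ge> 3" for i n :: nat
  proof
    assume "{i} = {..<n}"
    then have "card {i} = card {..<n}" by simp
    then show False using that by simp
  qed
  \<comment> \<open>An element supported on one index is automatically a zero-divisor, so the class
    of \<open>i\<close> in the graph is the full set of such elements and has one element less than
    the factor.\<close>
  have orders: "order (Fs ! i) = order (Gs ! \<sigma> i)" if i: "i < length Fs" for i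
  proof -
    have \<sigma>i: "\<sigma> i < length Gs" using \<sigma> i by (auto simp: bij_betw_def)
    have "{x \<in> ?V. ?s x = {i}} = {x \<in> carrier R. product_support Fs (\<phi> x) = {i}}"
      using singleton_proper[OF assms(7)] by (auto simp: R.nonzero_zero_divisors_eq)
    moreover have "{y \<in> ?W. ?u y = {\<sigma> i}} = {y \<in> carrier S. product_support Gs (\<psi> y) = {\<sigma> i}}"
      using singleton_proper[OF assms(8)] by (auto simp: S.nonzero_zero_divisors_eq)
    ultimately show ?thesis
      using cards[OF i] card_singleton_product_support[OF \<phi> _ i]
        card_singleton_product_support[OF \<psi> _ \<sigma>i] fields i \<sigma>i by simp
  qed
  have "mset (map order Fs) = image_mset (\<lambda>i. order (Gs ! \<sigma> i)) (mset_set {..<length Fs})"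
    unfolding mset_map_nth using orders by (intro image_mset_cong) auto
  also have "\<dots> = image_mset (\<lambda>j. order (Gs ! j)) (image_mset \<sigma> (mset_set {..<length Fs}))"
    by (simp add: multiset.map_comp comp_def)
  also have "\<dots> = mset (map order Gs)"
    unfolding mset_map_nth using \<sigma> by (simp add: image_mset_mset_set bij_betw_def)
  finally have mset: "mset (map order Fs) = mset (map order Gs)" .
  have rings: "ring F" if "F \<in> set Fs" for F
    using fields(1)[OF that] by (simp add: field_def domain_def cring_def)
  have rings': "ring G" if "G \<in> set Gs" for G
    using fields(2)[OF that] by (simp add: field_def domain_def cring_def)
  have "Fs ! i \<simeq> Gs ! \<sigma> i" if i: "i < length Fs" for i
  proof -
    have "\<sigma> i < length Gs" using \<sigma> i by (auto simp: bij_betw_def)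
    then show ?thesis
      using fields i by (intro finite_fields_same_order_iso orders) auto
  qed
  then have "RDirProd_list Fs \<simeq> RDirProd_list Gs"
    by (intro RDirProd_list_permute_iso[OF rings rings' \<sigma>])
  then have "R \<simeq> S"
    using ring_iso_trans[OF ring_iso_trans[OF assms(9)] ring_iso_sym[OF S.ring_axioms assms(10)]]
    by simp
  with len mset show ?thesis by blast
qed

end
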